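(* Let $\lambda\ge 0$ and $t\in\left(\frac{\sqrt2}{2},1\right]$, and let $f(z)=z+\sum_{n=2}^{\infty}a_nz^n$ belong to the class $H_\Sigma(\lambda,t)$. Then $$|a_2|\le \frac{2t\sqrt{2t}}{\sqrt{\left|(1+\lambda)^2-4(\lambda+\lambda^2)t^2\right|}}$$ (this bound being asserted when the denominator is nonzero), and $$|a_3|\le \frac{4t^2}{(1+\lambda)^2}+\frac{t}{1+2\lambda}.$$
   Context: Let $D=\{z\in\mathbb{C}:|z|<1\}$. $A$ is the class of functions $f$ analytic in $D$ with $f(0)=0$, $f'(0)=1$, so $f(z)=z+\sum_{n=2}^\infty a_nz^n$. A function $f\in A$ is bi-univalent in $D$ if both $f$ and $f^{-1}$ are univalent in $D$. Here $f^{-1}$ is the inverse of $f$, defined a priori on a disk $|w|<r_0(f)$ with $r_0(f)\ge 1/4$; for $f$ bi-univalent, $f^{-1}$ is understood as its univalent analytic continuation to all of $D$. $\Sigma$ denotes the class of bi-univalent functions. Near $0$, $f^{-1}(w)=w-a_2w^2+(2a_2^2-a_3)w^3-\cdots$. For $F,G$ analytic in $D$, $F$ is subordinate to $G$, written $F\prec G$, if there is an analytic function $\omega$ on $D$ with $\omega(0)=0$ and $|\omega(z)|<1$ for $z\in D$ such that $F(z)=G(\omega(z))$ for all $z\in D$. For $\lambda\ge 0$ and $t\in\left(\frac{\sqrt2}{2},1\right]$, the class $H_\Sigma(\lambda,t)$ consists of all $f\in\Sigma$ such that, with $g=f^{-1}$ and $H(z,t)=\frac{1}{1-2tz+z^2}$,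 $$(1-\lambda)\frac{zf'(z)}{f(z)}+\lambda\left(1+\frac{zf''(z)}{f'(z)}\right)\prec H(z,t)\quad(z\in D)$$ and $$(1-\lambda)\frac{wg'(w)}{g(w)}+\lambda\left(1+\frac{wg''(w)}{g'(w)}\right)\prec H(w,t)\quad(w\in D),$$ where $\frac{zf'(z)}{f(z)}$ and $\frac{wg'(w)}{g(w)}$ are given the value $1$ at the origin (removable singularity). *)

theory Defs
  imports "HOL-Complex_Analysis.Complex_Analysis"
begin

abbreviation unit_disk :: "complex set" where
  "unit_disk \<equiv> ball 0 1"

definition class_A :: "(complex \<Rightarrow> complex) set" where
  "class_A = {f. f holomorphic_on unit_disk \<and> f 0 = 0 \<and> deriv f 0 = 1}"

text \<open>
  \<open>g\<close> is the univalent analytic continuation to the unit disk of the local inverse of \<open>f\<close> at 0.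
  The image of \<open>g\<close> need not lie in the unit disk, so \<open>f (g w) = w\<close> is not required for
  all \<open>w\<close>.
\<close>
definition univalent_inverse :: "(complex \<Rightarrow> complex) \<Rightarrow> (complex \<Rightarrow> complex) \<Rightarrow> bool" where
  "univalent_inverse f g \<longleftrightarrow>
     g holomorphic_on unit_disk \<and> inj_on g unit_disk \<and>
     (\<exists>r>0. ball 0 r \<subseteq> f ` unit_disk \<and> (\<forall>w\<in>ball 0 r. g w = the_inv_into unit_disk f w))"

text \<open>
  On the unit disk the continuation is unique, so that quantifying existentially over it (as is
  done below) amounts to speaking about the inverse of \<open>f\<close>.
\<close>
lemma univalent_inverse_unique:
  assumes "univalent_inverse f g" "univalent_inverse f h" "w \<in> unit_disk"
  shows "g w = h w"
proof -
  obtain r where r: "r > 0" "\<forall>w\<in>ball 0 r. g w = the_inv_into unit_disk f w"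
    using assms(1) by (auto simp: univalent_inverse_def)
  obtain s where s: "s > 0" "\<forall>w\<in>ball 0 s. h w = the_inv_into unit_disk f w"
    using assms(2) by (auto simp: univalent_inverse_def)
  define S :: "complex set" where "S = ball 0 (min 1 (min r s))"
  show ?thesis
  proof (rule analytic_continuation_open[of S unit_disk g h])
    show "S \<noteq> {}" using r(1) s(1) by (auto simp: S_def)
    show "g holomorphic_on unit_disk" "h holomorphic_on unit_disk"
      using assms(1,2) by (auto simp: univalent_inverse_def)
    show "g z = h z" if "z \<in> S" for z
      using that r(2) s(2) by (auto simp: S_def)
  qed (use assms(3) in \<open>auto simp: S_def\<close>)
qed

definition bi_univalent :: "(complex \<Rightarrow> complex) set" where
  "bi_univalent = {f \<in> class_A. inj_on f unit_disk \<and> (\<exists>g. univalent_inverse f g)}"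

definition subordinate :: "(complex \<Rightarrow> complex) \<Rightarrow> (complex \<Rightarrow> complex) \<Rightarrow> bool" where
  "subordinate F G \<longleftrightarrow>
     F holomorphic_on unit_disk \<and> G holomorphic_on unit_disk \<and>
     (\<exists>\<omega>. \<omega> holomorphic_on unit_disk \<and> \<omega> 0 = 0 \<and>
        (\<forall>z\<in>unit_disk. cmod (\<omega> z) < 1 \<and> F z = G (\<omega> z)))"

definition chebyshev_H :: "real \<Rightarrow> complex \<Rightarrow> complex" where
  "chebyshev_H t z = 1 / (1 - 2 * of_real t * z + z\<^sup>2)"

definition starlike_quotient :: "(complex \<Rightarrow> complex) \<Rightarrow> complex \<Rightarrow> complex" where
  "starlike_quotient f z = (if z = 0 then 1 else z * deriv f z / f z)"

definition convex_combination_op :: "real \<Rightarrow> (complex \<Rightarrow> complex) \<Rightarrow> complex \<Rightarrow> complex" where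
  "convex_combination_op lam f z =
     (1 - of_real lam) * starlike_quotient f z +
     of_real lam * (1 + z * deriv (deriv f) z / deriv f z)"

definition H_Sigma :: "real \<Rightarrow> real \<Rightarrow> (complex \<Rightarrow> complex) set" where
  "H_Sigma lam t =
     {f \<in> bi_univalent. \<exists>g. univalent_inverse f g \<and>
        subordinate (convex_combination_op lam f) (chebyshev_H t) \<and>
        subordinate (convex_combination_op lam g) (chebyshev_H t)}"

end

theory Submission
  imports Defs
begin

text \<open>
  Both bounds come from comparing Taylor coefficients of order one and two at the origin.
  Write the two subordinations as \<open>H(\<omega>(z))\<close> and \<open>H(\<eta>(w))\<close> with Schwarz functions
  \<open>\<omega> = c\<^sub>1 z + c\<^sub>2 z^2 + \<dots>\<close> and \<open>\<eta> = d\<^sub>1 w + d\<^sub>2 w^2 + \<dots>\<close>. Since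
  \<open>H = 1 + 2t z + (4t^2 - 1) z^2 + \<dots>\<close> and the inverse of \<open>f\<close> has coefficients \<open>-a\<^sub>2\<close> and
  \<open>2a\<^sub>2^2 - a\<^sub>3\<close>, this yields

  \<^item> \<open>(1 + \<lambda>) a\<^sub>2 = 2t c\<^sub>1\<close> and \<open>-(1 + \<lambda>) a\<^sub>2 = 2t d\<^sub>1\<close>,
  \<^item> \<open>2(1 + 2\<lambda>) a\<^sub>3 - (1 + 3\<lambda>) a\<^sub>2^2 = 2t c\<^sub>2 + (4t^2 - 1) c\<^sub>1^2\<close>,
  \<^item> \<open>2(1 + 2\<lambda>)(2a\<^sub>2^2 - a\<^sub>3) - (1 + 3\<lambda>) a\<^sub>2^2 = 2t d\<^sub>2 + (4t^2 - 1) d\<^sub>1^2\<close>.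

  Adding the last two equations eliminates \<open>a\<^sub>3\<close> and, after \<open>c\<^sub>1^2 = d\<^sub>1^2\<close> has been expressed by
  \<open>a\<^sub>2\<close>, leaves \<open>((1 + \<lambda>)^2 - 4(\<lambda> + \<lambda>^2)t^2) a\<^sub>2^2 = 4t^3 (c\<^sub>2 + d\<^sub>2)\<close>. Subtracting them
  eliminates \<open>c\<^sub>1\<close> and \<open>d\<^sub>1\<close> and leaves \<open>2(1 + 2\<lambda>)(a\<^sub>3 - a\<^sub>2^2) = t (c\<^sub>2 - d\<^sub>2)\<close>. All
  coefficients of a Schwarz function have modulus at most 1, which gives the two bounds.

  The comparison takes place in the ring of formal power series: every quotient is
  multiplied out to a polynomial identity that holds near 0, and uniqueness of
  the expansion turns it into an identity of series whose coefficients are read off.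
\<close>

section \<open>Power series expansions at the origin\<close>

lemma fps_expansion_tendsto_nhds:
  fixes f :: "complex \<Rightarrow> complex"
  assumes "f has_fps_expansion F"
  shows "(f \<longlongrightarrow> f 0) (nhds 0)"
  using has_fps_expansion_imp_continuous[OF assms, of UNIV]
  by (simp only: isCont_def tendsto_at_iff_tendsto_nhds)

lemma fps_expansion_eq_of_eventually_eq:
  fixes F G :: "complex fps"
  assumes "\<forall>\<^sub>F z in nhds 0. f z = g z" and "f has_fps_expansion F" and "g has_fps_expansion G"
  shows "F = G"
  using assms has_fps_expansion_cong[OF assms(1) refl] fps_expansion_unique_complex by blast

text \<open>
  Cauchy's inequality on the circles of radius \<open>r < 1\<close>, in the limit \<open>r \<rightarrow> 1\<close>, since
  the function need not extend continuously to the unit circle.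
\<close>
lemma norm_fps_nth_le_1_of_bounded:
  assumes "w holomorphic_on unit_disk" and "\<And>z. z \<in> unit_disk \<Longrightarrow> cmod (w z) \<le> 1"
    and "w has_fps_expansion W"
  shows "cmod (fps_nth W n) \<le> 1"
proof -
  have nth: "fps_nth W n = (deriv ^^ n) w 0 / fact n"
    using fps_nth_fps_expansion[OF assms(3)] .
  have bound: "cmod (fps_nth W n) * r ^ n \<le> 1" if r: "0 < r" "r < 1" for r :: real
  proof -
    have "cmod ((deriv ^^ n) w 0) \<le> fact n * 1 / r ^ n"
    proof (rule Cauchy_inequality)
      show "w holomorphic_on ball 0 r"
        using assms(1) by (rule holomorphic_on_subset) (use r in auto)
      show "continuous_on (cball 0 r) w"
        using assms(1) by (intro holomorphic_on_imp_continuous_on, rule holomorphic_on_subset)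
          (use r in auto)
    qed (use r assms(2) in auto)
    thus ?thesis
      using r by (simp add: nth norm_divide field_simps)
  qed
  have "((\<lambda>r. cmod (fps_nth W n) * r ^ n) \<longlongrightarrow> cmod (fps_nth W n) * 1 ^ n) (at_left 1)"
    by (intro tendsto_intros)
  moreover have "\<forall>\<^sub>F r in at_left (1::real). cmod (fps_nth W n) * r ^ n \<le> 1"
    using eventually_at_left_real[OF zero_less_one] by eventually_elim (auto intro: bound)
  ultimately show ?thesis
    using tendsto_upperbound by force
qed

section \<open>Coefficients forced by the subordination\<close>

text \<open>
  The factors \<open>2t\<close> and \<open>4t^2 - 1\<close> are the Chebyshev polynomials of the second kind
  \<open>U\<^sub>1(t)\<close> and \<open>U\<^sub>2(t)\<close>, the first Taylor coefficients of \<open>chebyshev_H t\<close>.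
\<close>
lemma subordinate_chebyshev_H_coeffs:
  assumes "subordinate \<Phi> (chebyshev_H t)" and "\<Phi> has_fps_expansion P"
  obtains c1 c2 :: complex where "cmod c1 \<le> 1" "cmod c2 \<le> 1"
    "fps_nth P 1 = of_real (2 * t) * c1"
    "fps_nth P 2 = of_real (2 * t) * c2 + of_real (4 * t\<^sup>2 - 1) * c1\<^sup>2"
proof -
  obtain w where w: "w holomorphic_on unit_disk" "w 0 = 0"
    "\<And>z. z \<in> unit_disk \<Longrightarrow> cmod (w z) < 1"
    "\<And>z. z \<in> unit_disk \<Longrightarrow> \<Phi> z = chebyshev_H t (w z)"
    using assms(1) by (auto simp: subordinate_def)
  define W where "W = fps_expansion w 0"
  have W: "w has_fps_expansion W"
    unfolding W_def using w(1) by (intro has_fps_expansion_fps_expansion[of unit_disk]) auto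
  have W0: "fps_nth W 0 = 0"
    using has_fps_expansion_imp_0_eq_fps_nth_0[OF W] w(2) by simp
  define D where "D = (\<lambda>z. 1 - 2 * complex_of_real t * w z + (w z)\<^sup>2)"
  have D: "D has_fps_expansion 1 - fps_const (2 * complex_of_real t) * W + W\<^sup>2"
    unfolding D_def by (intro fps_expansion_intros W)
  have "\<forall>\<^sub>F z in nhds 0. D z \<noteq> 0"
    using fps_expansion_tendsto_nhds[OF D] by (rule tendsto_imp_eventually_ne) (simp add: D_def w(2))
  moreover have "\<forall>\<^sub>F z in nhds 0. z \<in> unit_disk"
    by (intro eventually_nhds_in_open) auto
  ultimately have "\<forall>\<^sub>F z in nhds 0. \<Phi> z * D z = 1"
    by eventually_elim (auto simp: w(4) chebyshev_H_def D_def)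
  moreover have "(\<lambda>z. \<Phi> z * D z) has_fps_expansion
      P * (1 - fps_const (2 * complex_of_real t) * W + W\<^sup>2)"
    by (intro fps_expansion_intros assms(2) D)
  ultimately have eq: "P * (1 - fps_const (2 * complex_of_real t) * W + W\<^sup>2) = 1"
    using has_fps_expansion_1 by (rule fps_expansion_eq_of_eventually_eq)
  have P0: "fps_nth P 0 = 1"
    using arg_cong[OF eq, of "\<lambda>A. fps_nth A 0"] W0 by (simp add: power2_eq_square)
  have P1: "fps_nth P 1 = of_real (2 * t) * fps_nth W 1"
    using arg_cong[OF eq, of "\<lambda>A. fps_nth A 1"] W0 P0
    by (simp add: fps_mult_nth power2_eq_square)
  have P2: "fps_nth P 2 = of_real (2 * t) * fps_nth W 2 + of_real (4 * t\<^sup>2 - 1) * (fps_nth W 1)\<^sup>2"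
    using arg_cong[OF eq, of "\<lambda>A. fps_nth A 2"] W0 P0 P1
    by (simp add: fps_mult_nth power2_eq_square numeral_2_eq_2 algebra_simps)
  have "cmod (fps_nth W n) \<le> 1" for n
    using w(1) _ W by (rule norm_fps_nth_le_1_of_bounded) (use w(3) in force)
  thus ?thesis
    using that[OF _ _ P1 P2] by blast
qed

text \<open>
  Clearing denominators in the operator leaves an identity that also holds at the origin, so the
  case distinction in \<open>starlike_quotient\<close> disappears. Both sides then vanish at 0, hence the
  coefficients of order one and two of the operator sit in orders two and three.
\<close>
lemma convex_combination_op_coeffs:
  fixes F P :: "complex fps"
  assumes F: "f has_fps_expansion F" "fps_nth F 0 = 0" "fps_nth F 1 = 1"
    and P: "convex_combination_op lam f has_fps_expansion P"
  shows "fps_nth P 1 = of_real (1 + lam) * fps_nth F 2"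
    and "fps_nth P 2 = of_real (2 * (1 + 2 * lam)) * fps_nth F 3 -
           of_real (1 + 3 * lam) * (fps_nth F 2)\<^sup>2"
proof -
  let ?l = "complex_of_real lam"
  have f0: "f 0 = 0"
    using has_fps_expansion_imp_0_eq_fps_nth_0[OF F(1)] F(2) by simp
  have F': "deriv f has_fps_expansion fps_deriv F"
    by (intro fps_expansion_intros F(1))
  have F'': "deriv (deriv f) has_fps_expansion fps_deriv (fps_deriv F)"
    by (intro fps_expansion_intros F')
  have df0: "deriv f 0 = 1"
    using has_fps_expansion_imp_0_eq_fps_nth_0[OF F'] F(3) by simp
  have nz': "\<forall>\<^sub>F z in nhds 0. deriv f z \<noteq> 0"
    using fps_expansion_tendsto_nhds[OF F'] by (rule tendsto_imp_eventually_ne) (simp add: df0)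
  \<comment> \<open>Off the origin \<open>f\<close> must be shown not to vanish: at a zero the quotient would take its
    default value 0, and the cleared identity below could fail.\<close>
  have "f field_differentiable at 0"
    using has_fps_expansion_imp_analytic_0[OF F(1)] by (rule analytic_on_imp_differentiable_at) simp
  hence "(f has_field_derivative 1) (at 0)"
    using df0 by (metis field_differentiable_derivI)
  hence "((\<lambda>z. f z / z) \<longlongrightarrow> 1) (at 0)"
    using f0 by (simp add: has_field_derivative_iff)
  hence "\<forall>\<^sub>F z in at 0. f z / z \<noteq> 0"
    by (rule tendsto_imp_eventually_ne) simp
  hence nz: "\<forall>\<^sub>F z in nhds 0. z \<noteq> 0 \<longrightarrow> f z \<noteq> 0"
    by (simp add: eventually_at_filter eventually_mono)
  let ?L = "\<lambda>z. f z * deriv f z * convex_combination_op lam f z"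
  let ?R = "\<lambda>z. (1 - ?l) * (z * (deriv f z * deriv f z)) +
     ?l * (f z * deriv f z + z * (f z * deriv (deriv f) z))"
  have "\<forall>\<^sub>F z in nhds 0. ?L z = ?R z"
    using nz' nz
  proof eventually_elim
    case (elim z)
    thus ?case
      by (cases "z = 0")
        (auto simp: convex_combination_op_def starlike_quotient_def f0 field_simps)
  qed
  moreover have "?L has_fps_expansion F * fps_deriv F * P"
    by (intro fps_expansion_intros F(1) F' P)
  moreover have "?R has_fps_expansion fps_const (1 - ?l) * (fps_X * (fps_deriv F * fps_deriv F)) +
      fps_const ?l * (F * fps_deriv F + fps_X * (F * fps_deriv (fps_deriv F)))"
    by (intro fps_expansion_intros F(1) F' F'')
  ultimately have eq: "F * fps_deriv F * P =
      fps_const (1 - ?l) * (fps_X * (fps_deriv F * fps_deriv F)) +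
      fps_const ?l * (F * fps_deriv F + fps_X * (F * fps_deriv (fps_deriv F)))"
    by (rule fps_expansion_eq_of_eventually_eq)
  note expand = fps_mult_nth numeral_2_eq_2 numeral_3_eq_3 power2_eq_square
  have F1: "fps_nth F (Suc 0) = 1"
    using F(3) by simp
  have P0: "fps_nth P 0 = 1"
    using arg_cong[OF eq, of "\<lambda>A. fps_nth A 1"] F(2) F1 by (simp add: expand)
  show P1: "fps_nth P 1 = of_real (1 + lam) * fps_nth F 2"
    using arg_cong[OF eq, of "\<lambda>A. fps_nth A 2"] F(2) F1 P0
    by (simp add: expand algebra_simps)
  show "fps_nth P 2 = of_real (2 * (1 + 2 * lam)) * fps_nth F 3 -
           of_real (1 + 3 * lam) * (fps_nth F 2)\<^sup>2"
    using arg_cong[OF eq, of "\<lambda>A. fps_nth A 3"] F(2) F1 P0 P1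
    by (simp add: expand algebra_simps)
qed

section \<open>Coefficients of the inverse function\<close>

lemma fps_left_inverse_coeffs:
  fixes F G :: "'a::comm_ring_1 fps"
  assumes "fps_nth F 0 = 0" "fps_nth F 1 = 1" and "G oo F = fps_X"
  shows "fps_nth G 0 = 0" "fps_nth G 1 = 1" "fps_nth G 2 = - fps_nth F 2"
    "fps_nth G 3 = 2 * (fps_nth F 2)\<^sup>2 - fps_nth F 3"
proof -
  note expand = fps_compose_nth fps_mult_nth numeral_2_eq_2 numeral_3_eq_3 power2_eq_square
  have F1: "fps_nth F (Suc 0) = 1"
    using assms(2) by simp
  show "fps_nth G 0 = 0"
    using arg_cong[OF assms(3), of "\<lambda>A. fps_nth A 0"] by simp
  show G1: "fps_nth G 1 = 1"
    using arg_cong[OF assms(3), of "\<lambda>A. fps_nth A 1"] assms(1) F1 by (simp add: expand)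
  show G2: "fps_nth G 2 = - fps_nth F 2"
    using arg_cong[OF assms(3), of "\<lambda>A. fps_nth A 2"] assms(1) F1 G1
    by (simp add: expand fps_X_nth eq_neg_iff_add_eq_0 add.commute)
  have "fps_nth F 3 + fps_nth G 2 * (2 * fps_nth F 2) + fps_nth G 3 = 0"
    using arg_cong[OF assms(3), of "\<lambda>A. fps_nth A 3"] assms(1) F1 G1
    by (simp add: expand fps_X_nth algebra_simps)
  thus "fps_nth G 3 = 2 * (fps_nth F 2)\<^sup>2 - fps_nth F 3"
    using G2 by (simp add: power2_eq_square algebra_simps eq_diff_eq add_eq_0_iff2)
qed

text \<open>
  By continuity \<open>f\<close> maps a neighbourhood of 0 into the disk on which \<open>g\<close> is the set-theoretic
  inverse of \<open>f\<close>, so \<open>g (f z) = z\<close> there; the identity of series is the expansion of this one.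
\<close>
lemma univalent_inverse_fps_compose:
  assumes "univalent_inverse f g" "inj_on f unit_disk" "f 0 = 0"
    and F: "f has_fps_expansion F" and G: "g has_fps_expansion G"
  shows "G oo F = fps_X"
proof -
  obtain r where r: "r > 0" "\<And>w. w \<in> ball 0 r \<Longrightarrow> g w = the_inv_into unit_disk f w"
    using assms(1) by (auto simp: univalent_inverse_def)
  have "(f \<longlongrightarrow> 0) (nhds 0)"
    using fps_expansion_tendsto_nhds[OF F] assms(3) by simp
  hence "\<forall>\<^sub>F z in nhds 0. f z \<in> ball 0 r"
    by (rule topological_tendstoD) (use r in auto)
  moreover have "\<forall>\<^sub>F z in nhds 0. z \<in> unit_disk"
    by (intro eventually_nhds_in_open) auto
  ultimately have "\<forall>\<^sub>F z in nhds 0. (g \<circ> f) z = z"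
    by eventually_elim (simp add: r(2) the_inv_into_f_f[OF assms(2)])
  moreover have "(g \<circ> f) has_fps_expansion (G oo F)"
    using has_fps_expansion_imp_0_eq_fps_nth_0[OF F] assms(3)
    by (intro has_fps_expansion_compose F G) simp
  ultimately show ?thesis
    using has_fps_expansion_fps_X by (rule fps_expansion_eq_of_eventually_eq)
qed

section \<open>The coefficient bounds\<close>

text \<open>
  The elimination step, on the level of numbers. Here \<open>a\<close> and \<open>b\<close> are the second and third
  coefficient of the function, and the hypotheses are the four coefficient comparisons.
\<close>
lemma coefficient_bounds_of_comparison:
  fixes a b c1 c2 d1 d2 :: complex and lam t :: real
  assumes "lam \<ge> 0" "t > 0"
    and le: "cmod c1 \<le> 1" "cmod c2 \<le> 1" "cmod d2 \<le> 1"
    and f1: "of_real (1 + lam) * a = of_real (2 * t) * c1"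
    and f2: "of_real (2 * (1 + 2 * lam)) * b - of_real (1 + 3 * lam) * a\<^sup>2 =
               of_real (2 * t) * c2 + of_real (4 * t\<^sup>2 - 1) * c1\<^sup>2"
    and g1: "of_real (1 + lam) * (- a) = of_real (2 * t) * d1"
    and g2: "of_real (2 * (1 + 2 * lam)) * (2 * a\<^sup>2 - b) - of_real (1 + 3 * lam) * a\<^sup>2 =
               of_real (2 * t) * d2 + of_real (4 * t\<^sup>2 - 1) * d1\<^sup>2"
  shows "(1 + lam)\<^sup>2 - 4 * (lam + lam\<^sup>2) * t\<^sup>2 \<noteq> 0 \<Longrightarrow>
           cmod a \<le> 2 * t * sqrt (2 * t) / sqrt \<bar>(1 + lam)\<^sup>2 - 4 * (lam + lam\<^sup>2) * t\<^sup>2\<bar>"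
    and "cmod b \<le> 4 * t\<^sup>2 / (1 + lam)\<^sup>2 + t / (1 + 2 * lam)"
proof -
  define M where "M = (1 + lam)\<^sup>2 - 4 * (lam + lam\<^sup>2) * t\<^sup>2"
  have "complex_of_real (2 * t) * d1 = - (complex_of_real (1 + lam) * a)"
    using g1 by simp
  also have "\<dots> = of_real (2 * t) * (- c1)"
    unfolding f1 by simp
  finally have d1: "d1 = - c1"
    using \<open>t > 0\<close> unfolding mult_cancel_left by simp
  have add: "complex_of_real M * a\<^sup>2 = of_real (4 * t ^ 3) * (c2 + d2)"
  proof -
    have sum: "2 * (of_real (1 + lam) * a\<^sup>2) =
        of_real (2 * t) * (c2 + d2) + 2 * of_real (4 * t\<^sup>2 - 1) * c1\<^sup>2"
      using arg_cong2[OF f2 g2, of "(+)"] d1 by (simp add: algebra_simps)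
    have sq: "(of_real (1 + lam) * a)\<^sup>2 = (of_real (2 * t) * c1)\<^sup>2"
      using f1 by simp
    show ?thesis
      using sum sq unfolding M_def of_real_diff of_real_mult of_real_add of_real_power
        of_real_numeral of_real_1 by algebra
  qed
  have "\<bar>M\<bar> * (cmod a)\<^sup>2 = 4 * t ^ 3 * cmod (c2 + d2)"
    using arg_cong[OF add, of cmod] \<open>t > 0\<close>
    by (simp add: norm_mult norm_power del: of_real_mult of_real_power)
  moreover have "cmod (c2 + d2) \<le> 2"
    using norm_triangle_ineq[of c2 d2] le by linarith
  ultimately have "\<bar>M\<bar> * (cmod a)\<^sup>2 \<le> 4 * t ^ 3 * 2"
    using \<open>t > 0\<close> by (simp add: mult_left_mono)
  moreover have "4 * t ^ 3 * 2 = (2 * t * sqrt (2 * t))\<^sup>2"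
    using \<open>t > 0\<close> by (simp add: power_mult_distrib power2_eq_square[of t] power3_eq_cube)
  ultimately have sq: "\<bar>M\<bar> * (cmod a)\<^sup>2 \<le> (2 * t * sqrt (2 * t))\<^sup>2"
    by simp
  show "cmod a \<le> 2 * t * sqrt (2 * t) / sqrt \<bar>(1 + lam)\<^sup>2 - 4 * (lam + lam\<^sup>2) * t\<^sup>2\<bar>"
    if "(1 + lam)\<^sup>2 - 4 * (lam + lam\<^sup>2) * t\<^sup>2 \<noteq> 0"
  proof -
    have "(sqrt \<bar>M\<bar> * cmod a)\<^sup>2 \<le> (2 * t * sqrt (2 * t))\<^sup>2"
      using sq by (simp add: power_mult_distrib)
    hence "sqrt \<bar>M\<bar> * cmod a \<le> 2 * t * sqrt (2 * t)"
      by (rule power2_le_imp_le) (use \<open>t > 0\<close> in simp)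
    moreover have "sqrt \<bar>M\<bar> > 0"
      using that by (simp add: M_def)
    ultimately show ?thesis
      unfolding M_def[symmetric] by (simp add: pos_le_divide_eq mult.commute)
  qed
  have sub: "complex_of_real (2 * (1 + 2 * lam)) * (b - a\<^sup>2) = of_real t * (c2 - d2)"
  proof -
    have "2 * (complex_of_real (2 * (1 + 2 * lam)) * (b - a\<^sup>2)) = 2 * (of_real t * (c2 - d2))"
      using arg_cong2[OF f2 g2, of "(-)"] d1 by (simp add: algebra_simps)
    thus ?thesis by simp
  qed
  have "cmod (complex_of_real (2 * (1 + 2 * lam)) * (b - a\<^sup>2)) = cmod (of_real t * (c2 - d2))"
    by (simp only: sub)
  hence "2 * (1 + 2 * lam) * cmod (b - a\<^sup>2) = t * cmod (c2 - d2)"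
    using assms(1,2) unfolding norm_mult norm_of_real by simp
  moreover have "cmod (c2 - d2) \<le> 2"
    using norm_triangle_ineq4[of c2 d2] le by linarith
  ultimately have "2 * (1 + 2 * lam) * cmod (b - a\<^sup>2) \<le> t * 2"
    using \<open>t > 0\<close> by (simp add: mult_left_mono)
  hence diff: "cmod (b - a\<^sup>2) \<le> t / (1 + 2 * lam)"
    using assms(1) by (simp add: field_simps)
  have "complex_of_real (1 + lam) * a = of_real (2 * t) * c1"
    using f1 by simp
  hence "cmod (complex_of_real (1 + lam) * a) = cmod (of_real (2 * t) * c1)"
    by (rule arg_cong)
  hence "(1 + lam) * cmod a = 2 * t * cmod c1"
    using assms(1,2) unfolding norm_mult norm_of_real by simp
  hence "(1 + lam) * cmod a \<le> 2 * t"
    using le(1) \<open>t > 0\<close> by (simp add: mult_left_le)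
  hence "cmod a \<le> 2 * t / (1 + lam)"
    using assms(1) by (simp add: field_simps)
  hence "(cmod a)\<^sup>2 \<le> (2 * t / (1 + lam))\<^sup>2"
    by (rule power_mono) simp
  hence "cmod (a\<^sup>2) \<le> 4 * t\<^sup>2 / (1 + lam)\<^sup>2"
    by (simp add: norm_power power_divide power_mult_distrib)
  thus "cmod b \<le> 4 * t\<^sup>2 / (1 + lam)\<^sup>2 + t / (1 + 2 * lam)"
    using diff norm_triangle_sub[of b "a\<^sup>2"] by linarith
qed

theorem theorem2:
  fixes lam t :: real and f :: "complex \<Rightarrow> complex" and a :: "nat \<Rightarrow> complex"
  assumes "lam \<ge> 0" and "sqrt 2 / 2 < t" and "t \<le> 1"
    and "f \<in> H_Sigma lam t"
    and "\<And>z. z \<in> unit_disk \<Longrightarrow> (\<lambda>n. a (n + 2) * z ^ (n + 2)) sums (f z - z)"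
  shows "((1 + lam)\<^sup>2 - 4 * (lam + lam\<^sup>2) * t\<^sup>2 \<noteq> 0 \<longrightarrow>
           cmod (a 2) \<le> 2 * t * sqrt (2 * t) / sqrt \<bar>(1 + lam)\<^sup>2 - 4 * (lam + lam\<^sup>2) * t\<^sup>2\<bar>)
       \<and> cmod (a 3) \<le> 4 * t\<^sup>2 / (1 + lam)\<^sup>2 + t / (1 + 2 * lam)"
proof -
  obtain g where g: "univalent_inverse f g" and inj: "inj_on f unit_disk" and f0: "f 0 = 0"
    and subf: "subordinate (convex_combination_op lam f) (chebyshev_H t)"
    and subg: "subordinate (convex_combination_op lam g) (chebyshev_H t)"
    using assms(4) by (auto simp: H_Sigma_def bi_univalent_def class_A_def)
  have t: "t > 0"
    using assms(2) by (rule less_trans[rotated]) simp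
  have expansion: "h has_fps_expansion fps_expansion h 0" if "h holomorphic_on unit_disk" for h
    using that by (intro has_fps_expansion_fps_expansion[of unit_disk]) auto
  \<comment> \<open>The values \<open>a 0\<close> and \<open>a 1\<close> are arbitrary, so the first two coefficients are set by hand.\<close>
  define F where "F = Abs_fps (\<lambda>n. if n = 0 then 0 else if n = 1 then 1 else a n)"
  have F_nth: "fps_nth F 0 = 0" "fps_nth F 1 = 1" "fps_nth F 2 = a 2" "fps_nth F 3 = a 3"
    by (simp_all add: F_def)
  have "(\<lambda>n. fps_nth F n * z ^ n) sums f z" if "z \<in> unit_disk" for z
  proof -
    have "(\<lambda>n. fps_nth F (n + 2) * z ^ (n + 2)) sums (f z - z)"
      using assms(5)[OF that] by (simp add: F_def)
    thus ?thesis
      by (subst (asm) sums_iff_shift) (simp add: F_def numeral_2_eq_2)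
  qed
  hence F: "f has_fps_expansion F"
    by (intro has_fps_expansionI eventually_mono[OF eventually_nhds_in_open[of unit_disk]]) auto
  define G where "G = fps_expansion g 0"
  have G: "g has_fps_expansion G"
    unfolding G_def using g by (intro expansion) (simp add: univalent_inverse_def)
  note G_nth = fps_left_inverse_coeffs[OF F_nth(1,2)
      univalent_inverse_fps_compose[OF g inj f0 F G]]
  have P: "convex_combination_op lam f has_fps_expansion
      fps_expansion (convex_combination_op lam f) 0"
    using subf by (intro expansion) (simp add: subordinate_def)
  have Q: "convex_combination_op lam g has_fps_expansion
      fps_expansion (convex_combination_op lam g) 0"
    using subg by (intro expansion) (simp add: subordinate_def)
  obtain c1 c2 :: complex where c: "cmod c1 \<le> 1" "cmod c2 \<le> 1"
    "fps_nth (fps_expansion (convex_combination_op lam f) 0) 1 = of_real (2 * t) * c1"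
    "fps_nth (fps_expansion (convex_combination_op lam f) 0) 2 =
       of_real (2 * t) * c2 + of_real (4 * t\<^sup>2 - 1) * c1\<^sup>2"
    by (rule subordinate_chebyshev_H_coeffs[OF subf P])
  obtain d1 d2 :: complex where d: "cmod d2 \<le> 1"
    "fps_nth (fps_expansion (convex_combination_op lam g) 0) 1 = of_real (2 * t) * d1"
    "fps_nth (fps_expansion (convex_combination_op lam g) 0) 2 =
       of_real (2 * t) * d2 + of_real (4 * t\<^sup>2 - 1) * d1\<^sup>2"
    by (rule subordinate_chebyshev_H_coeffs[OF subg Q])
  note c_eqs = c(3,4)[unfolded convex_combination_op_coeffs[OF F F_nth(1,2) P] F_nth]
  note d_eqs = d(2,3)[unfolded convex_combination_op_coeffs[OF G G_nth(1,2) Q] G_nth F_nth power2_minus]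
  show ?thesis
    using coefficient_bounds_of_comparison[OF assms(1) t c(1,2) d(1) c_eqs d_eqs] by blast
qed

end
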